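(* Let $\mathbb{H}$ be an elementary abelian $2$-hypergroup, the constrained direct product of $\langle q_1\rangle,\dots,\langle q_p\rangle$ with $q_1,\dots,q_p$ involutions of $\mathbb{H}$. Let $\mathbb{G}\subseteq\mathbb{H}$ and let $r$ denote the unique element of $\mathbb{H}$ whose support consists of precisely all thick elements of $\mathbb{H}$ contained in $\{q_1,q_2,\dots,q_p\}$. Then $\mathbb{G}$ is a strongly normal closed subset of $\mathbb{H}$ if and only if $\mathrm{O}^\vartheta(\mathbb{G})=\mathrm{O}^\vartheta(\mathbb{H})=\langle r\rangle$ and there exists $\mathbb{F}\subseteq\mathbb{H}$ such that $\mathbb{F}^\gamma$ is a subgroup of the elementary abelian $2$-group $\mathrm{O}_\vartheta(\mathbb{H})^\gamma$, $\mathbb{G}=\langle r\rangle\mathbb{F}$, $\langle r\rangle\cap\mathbb{F}=\{e\}$, and $\mathrm{O}_\vartheta(\mathbb{G})=\mathbb{F}$.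
   Context: A hypergroup is a nonempty set $\mathbb{H}$ with a hypermultiplication $(a,b)\mapsto ab\subseteq\mathbb{H}$ and a map $a\mapsto a^*$ from $\mathbb{H}$ to $\mathbb{H}$ such that, writing $\mathbb{F}\mathbb{G}=\bigcup_{b\in\mathbb{F},c\in\mathbb{G}}bc$ for $\mathbb{F},\mathbb{G}\subseteq\mathbb{H}$ and $a\mathbb{G}=\{a\}\mathbb{G}$, $\mathbb{G}a=\mathbb{G}\{a\}$: (1) $(ab)c=a(bc)$ for all $a,b,c$; (2) there is a unique $e\in\mathbb{H}$ with $ea=\{a\}=ae$ for all $a$; (3) for all $a,b,c$ the conditions $a\in bc$, $b\in ac^*$, $c\in b^*a$ are pairwise equivalent. A nonempty $\mathbb{G}\subseteq\mathbb{H}$ is a closed subset of $\mathbb{H}$ if $\mathbb{G}^*\mathbb{G}\subseteq\mathbb{G}$, where $\mathbb{G}^*=\{a^*:a\in\mathbb{G}\}$. For $\mathbb{G}\subseteq\mathbb{H}$, $\langle\mathbb{G}\rangle$ is the intersection of all closed subsets of $\mathbb{H}$ containing $\mathbb{G}$, and $\langle a\rangle=\langle\{a\}\rangle$. An element $a$ is thin if $a^*a=\{e\}$ and thick otherwise. $\mathrm{O}_\vartheta(\mathbb{G})$ is the set of thin elements of $\mathbb{H}$ lying in $\mathbb{G}$. For closed subsets $\mathbb{F},\mathbb{G}$: $\mathbb{F}$ is normal in $\mathbb{G}$ if $\mathbb{F}\subseteq\mathbb{G}$ and $\mathbb{F}a=a\mathbb{F}$ for all $a\in\mathbb{G}$;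 $\mathbb{F}$ is a strongly normal closed subset of $\mathbb{G}$ if $a^*\mathbb{F}a\subseteq\mathbb{F}\subseteq\mathbb{G}$ for all $a\in\mathbb{G}$. For $\mathbb{G}\subseteq\mathbb{H}$, $\mathrm{O}^\vartheta(\mathbb{G})$ is the intersection of all strongly normal closed subsets of $\langle\mathbb{G}\rangle$. An involution is an element $a\neq e$ such that $\{e,a\}$ is closed. If $a,b$ are thin, then $ab$ is a singleton $\{c\}$ with $c$ thin. For $\mathbb{G}\subseteq\mathbb{H}$ put $\mathbb{G}^\gamma=\{\{a\}:a\in\mathbb{G}\}$; $\mathrm{O}_\vartheta(\mathbb{H})^\gamma$ carries the binary operation $\{a\}\bullet\{b\}=ab$ with identity $\{e\}$. Elementary abelian $2$-hypergroups: $\mathbb{H}$ is the direct product of normal closed subsets $\mathbb{G}_1,\dots,\mathbb{G}_p$ ($p\geq 1$) if, for each $i$, $\mathbb{H}=\mathbb{G}_i\widehat{\mathbb{G}_i}$ and $\mathbb{G}_i\cap\widehat{\mathbb{G}_i}=\{e\}$, where $\widehat{\mathbb{G}_i}=\prod_{j\neq i}\mathbb{G}_j$ (and $\widehat{\mathbb{G}_1}=\{e\}$ if $p=1$). Then for every $a\in\mathbb{H}$ there are unique $r_i\in\mathbb{G}_i$ ($1\le i\le p$) with $a\in r_1r_2\cdots r_p$; the set $\{r_1,\dots,r_p\}\setminus\{e\}$ is the support of $a$. The direct product is constrained if $r_1r_2\cdots r_p=\{a\}$ for every $a\in\mathbb{H}$. $\mathbb{H}$ is an elementary abelian $2$-hypergroup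 if it is the constrained direct product of closed subsets $\langle q_1\rangle,\dots,\langle q_p\rangle$ with $q_1,\dots,q_p$ involutions of $\mathbb{H}$ (so $\langle q_i\rangle=\{e,q_i\}$); supports are taken with respect to this fixed decomposition. The element with empty support is $e$. *)

theory Defs
  imports "HOL-Algebra.Group"
begin

record 'a hypergroup = "'a partial_object" +
  hmult :: "'a \<Rightarrow> 'a \<Rightarrow> 'a set"  (infixl \<open>\<cdot>\<index>\<close> 70)
  hstar :: "'a \<Rightarrow> 'a"

definition hset_mult :: "('a, 'b) hypergroup_scheme \<Rightarrow> 'a set \<Rightarrow> 'a set \<Rightarrow> 'a set"
    (infixl \<open>\<odot>\<index>\<close> 70)
  where "F \<odot>\<^bsub>H\<^esub> G = (\<Union>b\<in>F. \<Union>c\<in>G. b \<cdot>\<^bsub>H\<^esub> c)"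

definition is_hone :: "('a, 'b) hypergroup_scheme \<Rightarrow> 'a \<Rightarrow> bool"
  where "is_hone H e \<longleftrightarrow>
    e \<in> carrier H \<and> (\<forall>a\<in>carrier H. e \<cdot>\<^bsub>H\<^esub> a = {a} \<and> a \<cdot>\<^bsub>H\<^esub> e = {a})"

definition hone :: "('a, 'b) hypergroup_scheme \<Rightarrow> 'a"
  where "hone H = (THE e. is_hone H e)"

locale hypergroup =
  fixes H :: "('a, 'b) hypergroup_scheme" (structure)
  assumes nonempty: "carrier H \<noteq> {}"
    and hmult_closed: "\<lbrakk>a \<in> carrier H; b \<in> carrier H\<rbrakk> \<Longrightarrow> a \<cdot> b \<subseteq> carrier H"
    and hstar_closed: "a \<in> carrier H \<Longrightarrow> hstar H a \<in> carrier H"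
    and hassoc: "\<lbrakk>a \<in> carrier H; b \<in> carrier H; c \<in> carrier H\<rbrakk>
      \<Longrightarrow> (a \<cdot> b) \<odot> {c} = {a} \<odot> (b \<cdot> c)"
    and ex1_hone: "\<exists>!e. is_hone H e"
    and exchange_left: "\<lbrakk>a \<in> carrier H; b \<in> carrier H; c \<in> carrier H\<rbrakk>
      \<Longrightarrow> a \<in> b \<cdot> c \<longleftrightarrow> b \<in> a \<cdot> hstar H c"
    and exchange_right: "\<lbrakk>a \<in> carrier H; b \<in> carrier H; c \<in> carrier H\<rbrakk>
      \<Longrightarrow> a \<in> b \<cdot> c \<longleftrightarrow> c \<in> hstar H b \<cdot> a"


definition closed_subset :: "('a, 'b) hypergroup_scheme \<Rightarrow> 'a set \<Rightarrow> bool"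
  where "closed_subset H G \<longleftrightarrow>
    G \<noteq> {} \<and> G \<subseteq> carrier H \<and> (hstar H ` G) \<odot>\<^bsub>H\<^esub> G \<subseteq> G"

definition closure_of_set :: "('a, 'b) hypergroup_scheme \<Rightarrow> 'a set \<Rightarrow> 'a set"  (\<open>\<langle>_\<rangle>\<index>\<close>)
  where "\<langle>G\<rangle>\<^bsub>H\<^esub> = \<Inter>{K. closed_subset H K \<and> G \<subseteq> K}"

definition thin :: "('a, 'b) hypergroup_scheme \<Rightarrow> 'a \<Rightarrow> bool"
  where "thin H a \<longleftrightarrow> a \<in> carrier H \<and> hstar H a \<cdot>\<^bsub>H\<^esub> a = {hone H}"

definition thick :: "('a, 'b) hypergroup_scheme \<Rightarrow> 'a \<Rightarrow> bool"
  where "thick H a \<longleftrightarrow> a \<in> carrier H \<and> \<not> thin H a"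

definition normal_in :: "('a, 'b) hypergroup_scheme \<Rightarrow> 'a set \<Rightarrow> 'a set \<Rightarrow> bool"
  where "normal_in H F G \<longleftrightarrow>
    closed_subset H F \<and> closed_subset H G \<and> F \<subseteq> G \<and>
    (\<forall>a\<in>G. F \<odot>\<^bsub>H\<^esub> {a} = {a} \<odot>\<^bsub>H\<^esub> F)"

definition strongly_normal_in :: "('a, 'b) hypergroup_scheme \<Rightarrow> 'a set \<Rightarrow> 'a set \<Rightarrow> bool"
  where "strongly_normal_in H F G \<longleftrightarrow>
    closed_subset H F \<and> closed_subset H G \<and> F \<subseteq> G \<and>
    (\<forall>a\<in>G. {hstar H a} \<odot>\<^bsub>H\<^esub> F \<odot>\<^bsub>H\<^esub> {a} \<subseteq> F)"

text \<open>The operators written \<open>O\<close> with lower, respectively upper, index \<open>\<vartheta>\<close>.\<close>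

definition thin_part :: "('a, 'b) hypergroup_scheme \<Rightarrow> 'a set \<Rightarrow> 'a set"
  where "thin_part H G = {a \<in> G. thin H a}"

definition thin_residue :: "('a, 'b) hypergroup_scheme \<Rightarrow> 'a set \<Rightarrow> 'a set"
  where "thin_residue H G = \<Inter>{F. strongly_normal_in H F \<langle>G\<rangle>\<^bsub>H\<^esub>}"

definition involution :: "('a, 'b) hypergroup_scheme \<Rightarrow> 'a \<Rightarrow> bool"
  where "involution H a \<longleftrightarrow>
    a \<in> carrier H \<and> a \<noteq> hone H \<and> closed_subset H {hone H, a}"


text \<open>The set \<open>G\<^sup>\<gamma>\<close> of singletons, and the group of thin elements. On singletons,
  \<open>{a} \<odot> {b}\<close> is the hyperproduct of \<open>a\<close> and \<open>b\<close>, itself a singleton if both are thin.\<close>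

definition singletons :: "'a set \<Rightarrow> 'a set set"
  where "singletons G = (\<lambda>a. {a}) ` G"

definition thin_group :: "('a, 'b) hypergroup_scheme \<Rightarrow> 'a set monoid"
  where "thin_group H =
    \<lparr>carrier = singletons (thin_part H (carrier H)),
     monoid.mult = (\<lambda>A B. A \<odot>\<^bsub>H\<^esub> B),
     one = {hone H}\<rparr>"

definition elementary_abelian_2_group :: "('g, 'h) monoid_scheme \<Rightarrow> bool"
  where "elementary_abelian_2_group K \<longleftrightarrow>
    comm_group K \<and> (\<forall>x\<in>carrier K. x \<otimes>\<^bsub>K\<^esub> x = \<one>\<^bsub>K\<^esub>)"


text \<open>Products of finite lists of subsets, in the order of the list; the empty product is
  \<open>{e}\<close>. The factors of a direct product are indexed by \<open>{1..p}\<close>.\<close>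

definition hprod :: "('a, 'b) hypergroup_scheme \<Rightarrow> 'a set list \<Rightarrow> 'a set"
  where "hprod H Gs = foldr (\<lambda>F G. F \<odot>\<^bsub>H\<^esub> G) Gs {hone H}"

definition cofactor :: "('a, 'b) hypergroup_scheme \<Rightarrow> nat \<Rightarrow> (nat \<Rightarrow> 'a set) \<Rightarrow> nat \<Rightarrow> 'a set"
  where "cofactor H p G i = hprod H (map G (filter (\<lambda>j. j \<noteq> i) [1..<Suc p]))"

definition direct_product :: "('a, 'b) hypergroup_scheme \<Rightarrow> nat \<Rightarrow> (nat \<Rightarrow> 'a set) \<Rightarrow> bool"
  where "direct_product H p G \<longleftrightarrow> 1 \<le> p \<and>
    (\<forall>i\<in>{1..p}. normal_in H (G i) (carrier H) \<and>
      carrier H = G i \<odot>\<^bsub>H\<^esub> cofactor H p G i \<and>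
      G i \<inter> cofactor H p G i = {hone H})"

definition elem_prod :: "('a, 'b) hypergroup_scheme \<Rightarrow> nat \<Rightarrow> (nat \<Rightarrow> 'a) \<Rightarrow> 'a set"
  where "elem_prod H p r = hprod H (map (\<lambda>i. {r i}) [1..<Suc p])"

text \<open>In a direct product the components of an element exist and are unique; families are
  taken extensional (\<open>undefined\<close> outside \<open>{1..p}\<close>) so that they are unique as functions.\<close>

definition components ::
    "('a, 'b) hypergroup_scheme \<Rightarrow> nat \<Rightarrow> (nat \<Rightarrow> 'a set) \<Rightarrow> 'a \<Rightarrow> nat \<Rightarrow> 'a"
  where "components H p G a =
    (THE r. r \<in> (\<Pi>\<^sub>E i\<in>{1..p}. G i) \<and> a \<in> elem_prod H p r)"

definition supp :: "('a, 'b) hypergroup_scheme \<Rightarrow> nat \<Rightarrow> (nat \<Rightarrow> 'a set) \<Rightarrow> 'a \<Rightarrow> 'a set"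
  where "supp H p G a = components H p G a ` {1..p} - {hone H}"

definition constrained_direct_product ::
    "('a, 'b) hypergroup_scheme \<Rightarrow> nat \<Rightarrow> (nat \<Rightarrow> 'a set) \<Rightarrow> bool"
  where "constrained_direct_product H p G \<longleftrightarrow> direct_product H p G \<and>
    (\<forall>a\<in>carrier H. elem_prod H p (components H p G a) = {a})"

definition elementary_abelian_2_hypergroup ::
    "('a, 'b) hypergroup_scheme \<Rightarrow> nat \<Rightarrow> (nat \<Rightarrow> 'a) \<Rightarrow> bool"
  where "elementary_abelian_2_hypergroup H p q \<longleftrightarrow>
    hypergroup H \<and> (\<forall>i\<in>{1..p}. involution H (q i)) \<and>
    constrained_direct_product H p (\<lambda>i. \<langle>{q i}\<rangle>\<^bsub>H\<^esub>)"

end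

theory Submission
  imports Defs
begin

text \<open>Distinct involutions \<open>q i\<close>, \<open>q j\<close> commute because \<open>{e, q i}\<close> is normal, so a constrained
  product of the \<open>{e, q i}\<close> is a commutative hypergroup in which \<open>a\<^sup>* = a\<close> and in which products
  are computed componentwise. Hence strong normality of a closed set \<open>G\<close> means \<open>a a \<subseteq> G\<close> for all
  \<open>a\<close>. Componentwise, \<open>a a \<subseteq> r r\<close> for all \<open>a\<close>, and \<open>r r\<close> is the closed set generated by \<open>r\<close>;
  so the strongly normal closed subsets are exactly the closed subsets containing \<open>r\<close>. Such a
  subset splits since every \<open>a\<close> is the product of its thick components, which lies in \<open>r r\<close>, and
  of its thin components, which is thin.\<close>

context hypergroup
begin

section \<open>Neutral element, star and products of subsets in an arbitrary hypergroup\<close>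

lemma is_hone_hone: "is_hone H (hone H)"
  unfolding hone_def by (rule theI'[OF ex1_hone])

lemma hone_closed [simp]: "hone H \<in> carrier H"
  and hone_left [simp]: "a \<in> carrier H \<Longrightarrow> hone H \<cdot> a = {a}"
  and hone_right [simp]: "a \<in> carrier H \<Longrightarrow> a \<cdot> hone H = {a}"
  using is_hone_hone by (auto simp: is_hone_def)

text \<open>Exchange applied to \<open>a\<close> as an element of \<open>a\<close> times the neutral
  element.\<close>

lemma hone_in_star_mult: "a \<in> carrier H \<Longrightarrow> hone H \<in> hstar H a \<cdot> a"
  using exchange_right[of a a "hone H"] by simp

lemma hstar_hone [simp]: "hstar H (hone H) = hone H"
  using hone_in_star_mult[of "hone H"] hstar_closed[of "hone H"] by simp

lemma hstar_hstar [simp]: "a \<in> carrier H \<Longrightarrow> hstar H (hstar H a) = a"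
  using hone_in_star_mult[of a] exchange_right[of "hone H" "hstar H a" a]
  by (simp add: hstar_closed)

lemma hone_in_mult_iff:
  assumes "a \<in> carrier H" "b \<in> carrier H"
  shows "hone H \<in> a \<cdot> b \<longleftrightarrow> a = hstar H b"
  using exchange_left[of "hone H" a b] assms by (simp add: hstar_closed)

text \<open>Three exchanges rotate the membership until every element is starred; the order of the
  factors is reversed on the way.\<close>

lemma hstar_mult:
  assumes "a \<in> carrier H" "b \<in> carrier H" "c \<in> a \<cdot> b"
  shows "hstar H c \<in> hstar H b \<cdot> hstar H a"
proof -
  have c: "c \<in> carrier H"
    using assms hmult_closed by blast
  have "a \<in> c \<cdot> hstar H b"
    using exchange_left[of c a b] assms c by simp
  then have "hstar H b \<in> hstar H c \<cdot> a"
    using exchange_right[of a c "hstar H b"] assms c by (simp add: hstar_closed)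
  then show ?thesis
    using exchange_left[of "hstar H b" "hstar H c" a] assms c by (simp add: hstar_closed)
qed

lemma hset_mult_iff: "x \<in> A \<odot> B \<longleftrightarrow> (\<exists>a\<in>A. \<exists>b\<in>B. x \<in> a \<cdot> b)"
  by (auto simp: hset_mult_def)

lemma hset_mult_singletons [simp]: "{a} \<odot> {b} = a \<cdot> b"
  by (simp add: hset_mult_def)

lemma hset_mult_mono: "\<lbrakk>A \<subseteq> A'; B \<subseteq> B'\<rbrakk> \<Longrightarrow> A \<odot> B \<subseteq> A' \<odot> B'"
  unfolding hset_mult_def by blast

lemma hset_mult_commuteI:
  assumes "\<And>a b. \<lbrakk>a \<in> A; b \<in> B\<rbrakk> \<Longrightarrow> a \<cdot> b = b \<cdot> a"
  shows "A \<odot> B = B \<odot> A"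
  unfolding set_eq_iff hset_mult_iff using assms by (metis (no_types))

lemma hset_mult_closed: "\<lbrakk>A \<subseteq> carrier H; B \<subseteq> carrier H\<rbrakk> \<Longrightarrow> A \<odot> B \<subseteq> carrier H"
  unfolding hset_mult_def using hmult_closed by blast

lemma hset_mult_hone_left [simp]: "A \<subseteq> carrier H \<Longrightarrow> {hone H} \<odot> A = A"
  and hset_mult_hone_right [simp]: "A \<subseteq> carrier H \<Longrightarrow> A \<odot> {hone H} = A"
  by (auto simp: hset_mult_def subset_iff)

text \<open>Were the product of \<open>a\<close> and \<open>b\<close> empty, so would be its left
  multiple by the star of \<open>a\<close>. By associativity that multiple contains
  \<open>b\<close>, since the neutral element lies in \<open>hstar H a\<close> times
  \<open>a\<close>.\<close>

lemma hmult_nonempty: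
  assumes "a \<in> carrier H" "b \<in> carrier H"
  shows "a \<cdot> b \<noteq> {}"
proof
  assume "a \<cdot> b = {}"
  then have "{hstar H a} \<odot> (a \<cdot> b) = {}"
    by (simp add: hset_mult_def)
  moreover have "b \<in> (hstar H a \<cdot> a) \<odot> {b}"
    using hone_in_star_mult[OF assms(1)] assms(2) by (auto simp: hset_mult_iff intro: bexI[of _ "hone H"])
  ultimately show False
    using hassoc[of "hstar H a" a b] assms by (simp add: hstar_closed)
qed

lemma hset_mult_assoc:
  assumes "A \<subseteq> carrier H" "B \<subseteq> carrier H" "C \<subseteq> carrier H"
  shows "(A \<odot> B) \<odot> C = A \<odot> (B \<odot> C)"
proof -
  have "(A \<odot> B) \<odot> C = (\<Union>a\<in>A. \<Union>b\<in>B. \<Union>c\<in>C. (a \<cdot> b) \<odot> {c})"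
    by (auto simp: hset_mult_def)
  also have "\<dots> = (\<Union>a\<in>A. \<Union>b\<in>B. \<Union>c\<in>C. {a} \<odot> (b \<cdot> c))"
    using assms by (intro SUP_cong refl hassoc) auto
  also have "\<dots> = A \<odot> (B \<odot> C)"
    by (auto simp: hset_mult_def)
  finally show ?thesis .
qed

lemma hset_mult_left_commute:
  assumes "A \<subseteq> carrier H" "B \<subseteq> carrier H" "C \<subseteq> carrier H" "A \<odot> B = B \<odot> A"
  shows "A \<odot> (B \<odot> C) = B \<odot> (A \<odot> C)"
  using hset_mult_assoc[of A B C] hset_mult_assoc[of B A C] assms by simp

section \<open>Closed subsets and involutions\<close>

lemma closed_subset_hone:
  assumes "closed_subset H K"
  shows "hone H \<in> K"
proof -
  obtain a where "a \<in> K" "a \<in> carrier H"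
    using assms by (auto simp: closed_subset_def)
  then show ?thesis
    using assms hone_in_star_mult by (fastforce simp: closed_subset_def hset_mult_def)
qed

lemma closed_subset_carrier: "closed_subset H (carrier H)"
  using nonempty hstar_closed hmult_closed
  by (fastforce simp: closed_subset_def hset_mult_def)

lemma closure_of_set_subset: "\<lbrakk>closed_subset H K; A \<subseteq> K\<rbrakk> \<Longrightarrow> \<langle>A\<rangle> \<subseteq> K"
  by (auto simp: closure_of_set_def)

lemma subset_closure_of_set: "A \<subseteq> \<langle>A\<rangle>"
  by (auto simp: closure_of_set_def)

lemma closure_of_closed_subset: "closed_subset H K \<Longrightarrow> \<langle>K\<rangle> = K"
  using closure_of_set_subset[of K K] subset_closure_of_set[of K] by blast

lemma closure_involution:
  assumes "involution H a"
  shows "\<langle>{a}\<rangle> = {hone H, a}"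
proof
  show "\<langle>{a}\<rangle> \<subseteq> {hone H, a}"
    using assms by (intro closure_of_set_subset) (auto simp: involution_def)
  show "{hone H, a} \<subseteq> \<langle>{a}\<rangle>"
    by (auto simp: closure_of_set_def closed_subset_hone)
qed

text \<open>Closedness of the pair, applied to \<open>a\<close> and the neutral element, puts the
  star of \<open>a\<close> into the pair. It is not the neutral element, because starring twice
  gives \<open>a\<close> back.\<close>

lemma involution_hstar:
  assumes "involution H a"
  shows "hstar H a = a"
proof -
  have a: "a \<in> carrier H" "a \<noteq> hone H" "closed_subset H {hone H, a}"
    using assms by (auto simp: involution_def)
  then have "hstar H a \<cdot> hone H \<subseteq> {hone H, a}"
    by (auto simp: closed_subset_def hset_mult_def)
  then have "hstar H a \<in> {hone H, a}"
    using a hstar_closed by simp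
  moreover have "hstar H a \<noteq> hone H"
    using a hstar_hstar[of a] hstar_hone by metis
  ultimately show ?thesis by simp
qed

lemma involution_mult:
  assumes "involution H a"
  shows "a \<cdot> a = {hone H} \<or> a \<cdot> a = {hone H, a}"
proof -
  have a: "a \<in> carrier H" "closed_subset H {hone H, a}"
    using assms by (auto simp: involution_def)
  then have "a \<cdot> a \<subseteq> {hone H, a}"
    using involution_hstar[OF assms] by (auto simp: closed_subset_def hset_mult_def)
  moreover have "hone H \<in> a \<cdot> a"
    using hone_in_star_mult[of a] a involution_hstar[OF assms] by simp
  ultimately show ?thesis by blast
qed

section \<open>Finite products of subsets\<close>

lemma hprod_Nil [simp]: "hprod H [] = {hone H}"
  and hprod_Cons [simp]: "hprod H (A # As) = A \<odot> hprod H As"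
  by (simp_all add: hprod_def)

lemma hprod_closed:
  "(\<And>i. i \<in> set js \<Longrightarrow> A i \<subseteq> carrier H) \<Longrightarrow> hprod H (map A js) \<subseteq> carrier H"
  by (induction js) (simp_all add: hset_mult_closed)

lemma hprod_singletons_nonempty:
  assumes "\<And>i. i \<in> set js \<Longrightarrow> {z i} \<subseteq> carrier H"
  shows "hprod H (map (\<lambda>i. {z i}) js) \<noteq> {}"
  using assms
proof (induction js)
  case (Cons j js)
  then obtain x where "x \<in> hprod H (map (\<lambda>i. {z i}) js)" by auto
  moreover from this have "x \<in> carrier H"
    using hprod_closed[of js "\<lambda>i. {z i}"] Cons.prems by auto
  ultimately show ?case
    using hmult_nonempty[of "z j" x] Cons.prems by (auto simp: hset_mult_def)
qed simp

lemma hprod_mono: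
  "(\<And>i. i \<in> set js \<Longrightarrow> A i \<subseteq> B i) \<Longrightarrow> hprod H (map A js) \<subseteq> hprod H (map B js)"
  by (induction js) (simp_all add: hset_mult_mono)

lemma hprod_cong:
  "(\<And>i. i \<in> set js \<Longrightarrow> A i = B i) \<Longrightarrow> hprod H (map A js) = hprod H (map B js)"
  by (metis map_eq_conv)

lemma hprod_hone: "hprod H (map (\<lambda>i. {hone H}) js) = {hone H}"
  by (induction js) auto

lemma hone_in_hprod:
  assumes "\<And>i. i \<in> set js \<Longrightarrow> hone H \<in> A i"
  shows "hone H \<in> hprod H (map A js)"
  using hprod_mono[of js "\<lambda>i. {hone H}" A] assms by (simp add: hprod_hone)

lemma hprod_commute:
  assumes "X \<subseteq> carrier H" "\<And>i. i \<in> set js \<Longrightarrow> A i \<subseteq> carrier H"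
    "\<And>i. i \<in> set js \<Longrightarrow> X \<odot> A i = A i \<odot> X"
  shows "X \<odot> hprod H (map A js) = hprod H (map A js) \<odot> X"
  using assms(2,3)
proof (induction js)
  case Nil
  then show ?case using assms(1) by simp
next
  case (Cons j js)
  have c: "A j \<subseteq> carrier H" "hprod H (map A js) \<subseteq> carrier H"
    using Cons.prems(1) by (auto intro!: hprod_closed)
  show ?case
    using hset_mult_left_commute[of X "A j" "hprod H (map A js)"] Cons c assms(1)
    by (simp add: hset_mult_assoc)
qed

text \<open>Since the factors commute pairwise, the factor \<open>A i\<close> can be moved to the
  front; distinctness ensures that the filter removes exactly one occurrence.\<close>

lemma hprod_extract:
  assumes "\<And>i. i \<in> set js \<Longrightarrow> A i \<subseteq> carrier H"
    "\<And>i j. \<lbrakk>i \<in> set js; j \<in> set js\<rbrakk> \<Longrightarrow> A i \<odot> A j = A j \<odot> A i"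
    "distinct js" "i \<in> set js"
  shows "hprod H (map A js) = A i \<odot> hprod H (map A (filter (\<lambda>j. j \<noteq> i) js))"
  using assms
proof (induction js)
  case (Cons j js)
  show ?case
  proof (cases "i = j")
    case True
    then have "filter (\<lambda>j. j \<noteq> i) js = js"
      using Cons.prems by (auto simp: filter_id_conv)
    then show ?thesis using True by simp
  next
    case False
    have "hprod H (map A js) = A i \<odot> hprod H (map A (filter (\<lambda>j. j \<noteq> i) js))"
      using Cons False by auto
    moreover have "hprod H (map A (filter (\<lambda>j. j \<noteq> i) js)) \<subseteq> carrier H"
      using Cons.prems(1) by (intro hprod_closed) auto
    ultimately show ?thesis
      using False Cons.prems hset_mult_left_commute[of "A j" "A i"] by simp
  qed
qed simp

text \<open>The interchange law: each \<open>B j\<close> moves left past the remaining factors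
  \<open>A i\<close>. It is what turns multiplication in a direct product into multiplication in
  each component.\<close>

lemma hprod_mult:
  assumes "\<And>i. i \<in> set js \<Longrightarrow> A i \<subseteq> carrier H" "\<And>i. i \<in> set js \<Longrightarrow> B i \<subseteq> carrier H"
    "\<And>i j. \<lbrakk>i \<in> set js; j \<in> set js\<rbrakk> \<Longrightarrow> A i \<odot> B j = B j \<odot> A i"
  shows "hprod H (map A js) \<odot> hprod H (map B js) = hprod H (map (\<lambda>i. A i \<odot> B i) js)"
  using assms
proof (induction js)
  case (Cons j js)
  let ?A = "hprod H (map A js)" and ?B = "hprod H (map B js)"
  have c: "A j \<subseteq> carrier H" "B j \<subseteq> carrier H" "?A \<subseteq> carrier H" "?B \<subseteq> carrier H"
    using Cons.prems by (auto intro!: hprod_closed)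
  have "B j \<odot> ?A = ?A \<odot> B j"
    using Cons.prems by (intro hprod_commute) auto
  then have "(A j \<odot> ?A) \<odot> (B j \<odot> ?B) = (A j \<odot> B j) \<odot> (?A \<odot> ?B)"
    using hset_mult_left_commute[of "?A" "B j" "?B"] c
    by (simp add: hset_mult_assoc hset_mult_closed)
  moreover have "?A \<odot> ?B = hprod H (map (\<lambda>i. A i \<odot> B i) js)"
    using Cons by simp
  ultimately show ?case by simp
qed simp

text \<open>The star reverses the order of a product, and commutation of the factors restores
  it.\<close>

lemma hprod_hstar:
  assumes "\<And>i. i \<in> set js \<Longrightarrow> A i \<subseteq> carrier H" "\<And>i. i \<in> set js \<Longrightarrow> hstar H ` A i \<subseteq> A i"
    "\<And>i j. \<lbrakk>i \<in> set js; j \<in> set js\<rbrakk> \<Longrightarrow> A i \<odot> A j = A j \<odot> A i"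
  shows "hstar H ` hprod H (map A js) \<subseteq> hprod H (map A js)"
  using assms
proof (induction js)
  case (Cons j js)
  let ?P = "hprod H (map A js)"
  have c: "A j \<subseteq> carrier H" "?P \<subseteq> carrier H"
    using Cons.prems by (auto intro!: hprod_closed)
  have P: "hstar H ` ?P \<subseteq> ?P"
    using Cons by simp
  have "hstar H ` (A j \<odot> ?P) \<subseteq> ?P \<odot> A j"
  proof
    fix y assume "y \<in> hstar H ` (A j \<odot> ?P)"
    then obtain a b x where "a \<in> A j" "b \<in> ?P" "x \<in> a \<cdot> b" "y = hstar H x"
      by (auto simp: hset_mult_def)
    then show "y \<in> ?P \<odot> A j"
      using hstar_mult[of a b x] c P Cons.prems(2)[of j]
      by (fastforce simp: hset_mult_iff)
  qed
  also have "?P \<odot> A j = A j \<odot> ?P"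
    using Cons.prems by (intro hprod_commute[symmetric]) auto
  finally show ?case by simp
qed simp

text \<open>One factor is chosen from each set. Distinctness lets the choices be recorded in a
  single function of the index: changing \<open>z\<close> at the head leaves the product over the
  tail as it is.\<close>

lemma in_hprodD:
  assumes "x \<in> hprod H (map A js)" "distinct js"
  shows "\<exists>z. (\<forall>i\<in>set js. z i \<in> A i) \<and> x \<in> hprod H (map (\<lambda>i. {z i}) js)"
  using assms
proof (induction js arbitrary: x)
  case (Cons j js)
  obtain a y where ay: "a \<in> A j" "y \<in> hprod H (map A js)" "x \<in> a \<cdot> y"
    using Cons.prems(1) by (auto simp: hset_mult_iff)
  obtain z where z: "\<forall>i\<in>set js. z i \<in> A i" "y \<in> hprod H (map (\<lambda>i. {z i}) js)"
    using Cons.IH[OF ay(2)] Cons.prems(2) by auto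
  have "hprod H (map (\<lambda>i. {(z(j := a)) i}) js) = hprod H (map (\<lambda>i. {z i}) js)"
    using Cons.prems(2) by (intro hprod_cong) auto
  then show ?case
    using ay z by (intro exI[of _ "z(j := a)"]) (auto simp: hset_mult_iff)
qed auto

end

section \<open>Decomposition of an elementary abelian 2-hypergroup into components\<close>

locale constrained_involutions = hypergroup H for H :: "('a, 'b) hypergroup_scheme" (structure) +
  fixes p :: nat and q :: "nat \<Rightarrow> 'a"
  assumes eah: "elementary_abelian_2_hypergroup H p q"
begin

abbreviation cprod :: "(nat \<Rightarrow> 'a set) \<Rightarrow> 'a set"
  where "cprod A \<equiv> hprod H (map A [1..<Suc p])"

abbreviation comp :: "'a \<Rightarrow> nat \<Rightarrow> 'a"
  where "comp \<equiv> components H p (\<lambda>i. \<langle>{q i}\<rangle>)"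

declare upt_Suc [simp del] One_nat_def [simp del]

lemma indices [simp]: "set [1..<Suc p] = {1..p}"
  by auto

lemma involution_q: "i \<in> {1..p} \<Longrightarrow> involution H (q i)"
  using eah by (auto simp: elementary_abelian_2_hypergroup_def)

lemma q_closed [simp]: "i \<in> {1..p} \<Longrightarrow> q i \<in> carrier H"
  and q_neq_hone: "i \<in> {1..p} \<Longrightarrow> q i \<noteq> hone H"
  using involution_q by (auto simp: involution_def)

lemma closure_q: "i \<in> {1..p} \<Longrightarrow> \<langle>{q i}\<rangle> = {hone H, q i}"
  by (simp add: closure_involution involution_q)

lemma direct_product_q: "direct_product H p (\<lambda>i. \<langle>{q i}\<rangle>)"
  using eah by (auto simp: elementary_abelian_2_hypergroup_def constrained_direct_product_def)

lemma cofactor_q: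
  "cofactor H p (\<lambda>i. \<langle>{q i}\<rangle>) i =
    hprod H (map (\<lambda>j. {hone H, q j}) (filter (\<lambda>j. j \<noteq> i) [1..<Suc p]))"
  unfolding cofactor_def using indices by (intro hprod_cong closure_q) auto

lemma p_pos: "1 \<le> p"
  using direct_product_q by (simp add: direct_product_def)

lemma
  assumes "i \<in> {1..p}"
  shows q_normal: "a \<in> carrier H \<Longrightarrow> {hone H, q i} \<odot> {a} = {a} \<odot> {hone H, q i}"
    and carrier_decomp: "carrier H = {hone H, q i} \<odot>
      hprod H (map (\<lambda>j. {hone H, q j}) (filter (\<lambda>j. j \<noteq> i) [1..<Suc p]))"
    and cofactor_inter: "{hone H, q i} \<inter>
      hprod H (map (\<lambda>j. {hone H, q j}) (filter (\<lambda>j. j \<noteq> i) [1..<Suc p])) = {hone H}"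
proof -
  note * = bspec[OF direct_product_q[unfolded direct_product_def, THEN conjunct2] assms,
      unfolded closure_q[OF assms] cofactor_q normal_in_def]
  show "a \<in> carrier H \<Longrightarrow> {hone H, q i} \<odot> {a} = {a} \<odot> {hone H, q i}"
    using * by (elim conjE) (rule bspec)
  show "carrier H = {hone H, q i} \<odot>
      hprod H (map (\<lambda>j. {hone H, q j}) (filter (\<lambda>j. j \<noteq> i) [1..<Suc p]))"
    using * by (elim conjE)
  show "{hone H, q i} \<inter>
      hprod H (map (\<lambda>j. {hone H, q j}) (filter (\<lambda>j. j \<noteq> i) [1..<Suc p])) = {hone H}"
    using * by (elim conjE)
qed

text \<open>If two indices carried the same involution, it would lie in its own cofactor, which
  meets the pair \<open>{hone H, q i}\<close> only in the neutral element.\<close>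

lemma q_inj:
  assumes "i \<in> {1..p}" "j \<in> {1..p}" "q i = q j"
  shows "i = j"
proof (rule ccontr)
  let ?js = "filter (\<lambda>j. j \<noteq> i) [1..<Suc p]"
  assume "i \<noteq> j"
  then have j: "j \<in> set ?js" "set ?js \<subseteq> {1..p}" using assms(2) by auto
  \<comment> \<open>Stated for any list containing \<open>j\<close>, so that induction applies: take
    \<open>q j\<close> from the factor at \<open>j\<close> and the neutral element from all
    others.\<close>
  have "q j \<in> hprod H (map (\<lambda>k. {hone H, q k}) js)"
    if "j \<in> set js" "set js \<subseteq> {1..p}" for js
    using that
  proof (induction js)
    case (Cons k js)
    let ?P = "hprod H (map (\<lambda>k. {hone H, q k}) js)"
    have "q j \<in> q j \<cdot> hone H" "q j \<in> hone H \<cdot> q j"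
      using assms(2) by simp_all
    moreover have "hone H \<in> ?P"
      by (rule hone_in_hprod) simp
    moreover have "j = k \<or> q j \<in> ?P"
      using Cons by auto
    ultimately show ?case
      unfolding list.map hprod_Cons hset_mult_iff by blast
  qed simp
  from this[OF j] have "q i \<in> hprod H (map (\<lambda>k. {hone H, q k}) ?js)"
    using assms(3) by simp
  then have "q i \<in> {hone H}"
    unfolding cofactor_inter[OF assms(1), symmetric] by simp
  then show False
    using q_neq_hone[OF assms(1)] by simp
qed

text \<open>Normality of \<open>{hone H, q i}\<close> gives equality of the two products only after
  \<open>q j\<close> is adjoined to both sides. Neither product contains \<open>q j\<close>, so it
  can be removed again.\<close>

lemma q_commute:
  assumes "i \<in> {1..p}" "j \<in> {1..p}"
  shows "q i \<cdot> q j = q j \<cdot> q i"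
proof (cases "i = j")
  case False
  have notin: "q l \<notin> q k \<cdot> q l" if "k \<in> {1..p}" "l \<in> {1..p}" "k \<noteq> l" for k l
  proof
    \<comment> \<open>By exchange \<open>q k\<close> would lie in the square of \<open>q l\<close>,
      hence in \<open>{hone H, q l}\<close>, against the injectivity of \<open>q\<close>.\<close>
    assume "q l \<in> q k \<cdot> q l"
    then have "q k \<in> q l \<cdot> q l"
      using exchange_left[of "q l" "q k" "q l"] that by (simp add: involution_hstar involution_q)
    then have "q k \<in> {hone H, q l}"
      using involution_mult[OF involution_q[OF that(2)]] by auto
    then show False
      using that q_inj q_neq_hone by blast
  qed
  have notin': "q l \<notin> q l \<cdot> q k" if "k \<in> {1..p}" "l \<in> {1..p}" "k \<noteq> l" for k l
    using notin[OF that] hstar_mult[of "q l" "q k" "q l"] that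
    by (auto simp: involution_hstar involution_q)
  have "insert (q j) (q i \<cdot> q j) = insert (q j) (q j \<cdot> q i)"
    using q_normal[OF assms(1), of "q j"] assms by (simp add: hset_mult_def)
  then show ?thesis
    by (rule insert_ident[OF notin[OF assms False] notin'[OF assms False], THEN iffD1])
qed simp

lemma subset_components_commute:
  assumes "i \<in> {1..p}" "j \<in> {1..p}" "A \<subseteq> {hone H, q i}" "B \<subseteq> {hone H, q j}"
  shows "A \<odot> B = B \<odot> A"
proof (rule hset_mult_commuteI)
  fix a b assume "a \<in> A" "b \<in> B"
  then have "a \<in> {hone H, q i}" "b \<in> {hone H, q j}"
    using assms(3,4) by auto
  then show "a \<cdot> b = b \<cdot> a"
    using hone_left hone_right hone_closed q_closed[OF assms(1)] q_closed[OF assms(2)]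
      q_commute[OF assms(1,2)]
    by (metis insertE singletonD)
qed

lemma component_subset_carrier:
  "\<lbrakk>i \<in> {1..p}; A \<subseteq> {hone H, q i}\<rbrakk> \<Longrightarrow> A \<subseteq> carrier H"
  using q_closed by auto

lemma component_hstar: "\<lbrakk>i \<in> {1..p}; x \<in> {hone H, q i}\<rbrakk> \<Longrightarrow> hstar H x = x"
  using involution_hstar[OF involution_q] by (elim insertE emptyE) simp_all

lemma component_mult:
  assumes "i \<in> {1..p}" "x \<in> {hone H, q i}" "y \<in> {hone H, q i}"
  shows "x \<cdot> y \<subseteq> {hone H, q i}"
proof -
  have "q i \<cdot> q i \<subseteq> {hone H, q i}"
    using involution_mult[OF involution_q[OF assms(1)]] by (elim disjE) simp_all
  then show ?thesis
    using assms(2,3) q_closed[OF assms(1)] by (elim insertE emptyE) simp_all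
qed

text \<open>The interchange law for subsets of the components. It is kept for arbitrary lists of
  indices because it is applied both to full products and to cofactors.\<close>

lemma hprod_components_mult:
  assumes "set js \<subseteq> {1..p}" "\<And>i. i \<in> {1..p} \<Longrightarrow> A i \<subseteq> {hone H, q i}"
    "\<And>i. i \<in> {1..p} \<Longrightarrow> B i \<subseteq> {hone H, q i}"
  shows "hprod H (map A js) \<odot> hprod H (map B js) = hprod H (map (\<lambda>i. A i \<odot> B i) js)"
proof (rule hprod_mult)
  fix i assume "i \<in> set js"
  then have i: "i \<in> {1..p}" using assms(1) by blast
  then show "A i \<subseteq> carrier H" "B i \<subseteq> carrier H"
    using assms(2,3) component_subset_carrier by simp_all
  fix j assume "j \<in> set js"
  then have "j \<in> {1..p}" using assms(1) by blast
  with i show "A i \<odot> B j = B j \<odot> A i"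
    using assms(2,3) by (intro subset_components_commute)
qed

text \<open>Write \<open>a\<close> as an element of \<open>y i\<close> times \<open>b\<close> and of
  \<open>z i\<close> times \<open>c\<close>, with \<open>b\<close> and \<open>c\<close> in the
  cofactor. Solving for \<open>z i\<close> puts it into \<open>y i\<close> times some
  \<open>x\<close> from the cofactor. Exchange puts this \<open>x\<close> into
  \<open>{hone H, q i}\<close> as well, so \<open>x\<close> is the neutral element.\<close>

lemma cprod_components_unique:
  assumes "\<And>i. i \<in> {1..p} \<Longrightarrow> y i \<in> {hone H, q i}" "\<And>i. i \<in> {1..p} \<Longrightarrow> z i \<in> {hone H, q i}"
    and "a \<in> cprod (\<lambda>i. {y i})" "a \<in> cprod (\<lambda>i. {z i})" "i \<in> {1..p}"
  shows "y i = z i"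
proof -
  let ?js = "filter (\<lambda>j. j \<noteq> i) [1..<Suc p]"
  let ?C = "hprod H (map (\<lambda>j. {hone H, q j}) ?js)"
  have js: "set ?js \<subseteq> {1..p}" by auto
  have split: "\<exists>b\<in>?C. a \<in> x i \<cdot> b"
    if x: "\<And>i. i \<in> {1..p} \<Longrightarrow> x i \<in> {hone H, q i}" "a \<in> cprod (\<lambda>i. {x i})" for x
  proof -
    have "cprod (\<lambda>i. {x i}) = {x i} \<odot> hprod H (map (\<lambda>i. {x i}) ?js)"
    proof (rule hprod_extract)
      show "{x j} \<subseteq> carrier H" if "j \<in> set [1..<Suc p]" for j
        using component_subset_carrier[of j "{x j}"] x(1)[of j] that indices by blast
      show "{x j} \<odot> {x k} = {x k} \<odot> {x j}" if "j \<in> set [1..<Suc p]" "k \<in> set [1..<Suc p]" for j k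
        using subset_components_commute[of j k "{x j}" "{x k}"] x(1) that indices by blast
    qed (use assms(5) in auto)
    also have "\<dots> \<subseteq> {x i} \<odot> ?C"
      using js x(1) by (intro hset_mult_mono hprod_mono order_refl) blast
    finally show ?thesis
      using x(2) by (auto simp: hset_mult_iff)
  qed
  obtain b where b: "b \<in> ?C" "a \<in> y i \<cdot> b" using split[OF assms(1,3)] by blast
  obtain c where c: "c \<in> ?C" "a \<in> z i \<cdot> c" using split[OF assms(2,4)] by blast
  have C: "?C \<subseteq> carrier H"
    using js component_subset_carrier by (intro hprod_closed) blast
  \<comment> \<open>The cofactor is stable under star and under multiplication, so the quotient of
    \<open>b\<close> by \<open>c\<close> stays inside it.\<close>
  have "hstar H ` ?C \<subseteq> ?C"
  proof (rule hprod_hstar)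
    fix j assume "j \<in> set ?js"
    then show "{hone H, q j} \<subseteq> carrier H" "hstar H ` {hone H, q j} \<subseteq> {hone H, q j}"
      by (simp_all add: involution_hstar involution_q)
    fix k assume "k \<in> set ?js"
    with \<open>j \<in> set ?js\<close> show "{hone H, q j} \<odot> {hone H, q k} = {hone H, q k} \<odot> {hone H, q j}"
      using js by (intro subset_components_commute[of j k]) auto
  qed
  then have cC: "hstar H c \<in> ?C" using c by blast
  have "?C \<odot> ?C = hprod H (map (\<lambda>j. {hone H, q j} \<odot> {hone H, q j}) ?js)"
    using js by (intro hprod_components_mult) auto
  also have "\<dots> \<subseteq> ?C"
  proof (rule hprod_mono)
    fix j assume "j \<in> set ?js"
    then have "j \<in> {1..p}" by auto
    then show "{hone H, q j} \<odot> {hone H, q j} \<subseteq> {hone H, q j}"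
      using involution_mult[OF involution_q, of j] by (auto simp: hset_mult_def)
  qed
  finally have CC: "?C \<odot> ?C \<subseteq> ?C" .
  have yz: "y i \<in> carrier H" "z i \<in> carrier H"
    using assms(1)[OF assms(5)] assms(2)[OF assms(5)] q_closed[OF assms(5)] by auto
  have bc: "b \<in> carrier H" "c \<in> carrier H" "hstar H c \<in> carrier H" using b c cC C by auto
  then have a: "a \<in> carrier H" using b yz hmult_closed by blast
  have "z i \<in> a \<cdot> hstar H c"
    using exchange_left[of a "z i" c] c a bc yz by simp
  then have "z i \<in> (y i \<cdot> b) \<odot> {hstar H c}"
    using b(2) by (auto simp: hset_mult_iff)
  then have "z i \<in> {y i} \<odot> (b \<cdot> hstar H c)"
    using hassoc[of "y i" b "hstar H c"] bc yz by simp
  then obtain x where x: "x \<in> b \<cdot> hstar H c" "z i \<in> y i \<cdot> x"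
    by (auto simp: hset_mult_iff)
  have "x \<in> ?C \<odot> ?C"
    unfolding hset_mult_iff using x(1) b(1) cC by (intro bexI)
  then have xC: "x \<in> ?C" using CC by (rule rev_subsetD)
  then have xH: "x \<in> carrier H" using C by blast
  then have "x \<in> hstar H (y i) \<cdot> z i"
    using exchange_right[of "z i" "y i" x] yz x(2) by simp
  then have "x \<in> {hone H, q i}"
    using component_mult[OF assms(5) assms(1,2)[OF assms(5)]]
      component_hstar[OF assms(5) assms(1)[OF assms(5)]] by (simp add: subset_iff)
  then have "x \<in> {hone H}"
    using xC unfolding cofactor_inter[OF assms(5), symmetric] by simp
  then show ?thesis using x(2) yz by simp
qed

lemma elem_prod_eq: "elem_prod H p x = cprod (\<lambda>i. {x i})"
  by (simp add: elem_prod_def)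

lemma ex1_components:
  assumes "a \<in> carrier H"
  shows "\<exists>!x. x \<in> (\<Pi>\<^sub>E i\<in>{1..p}. \<langle>{q i}\<rangle>) \<and> a \<in> elem_prod H p x"
proof (rule ex_ex1I)
  \<comment> \<open>For the first index, factor times cofactor already lists all factors in the
    order of the full product, so the decomposition of the carrier at 1 is the full product.\<close>
  have "[1..<Suc p] = 1 # filter (\<lambda>j. j \<noteq> 1) [1..<Suc p]"
    using p_pos by (subst (1 2) upt_conv_Cons) (auto simp: filter_id_conv)
  from arg_cong[OF this, of "\<lambda>js. hprod H (map (\<lambda>j. {hone H, q j}) js)"]
  have "cprod (\<lambda>j. {hone H, q j}) = carrier H"
    using carrier_decomp[of 1] p_pos by simp
  then have a: "a \<in> cprod (\<lambda>j. {hone H, q j})"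
    using assms by (simp only:)
  obtain z where z: "\<forall>i\<in>{1..p}. z i \<in> {hone H, q i}" "a \<in> cprod (\<lambda>i. {z i})"
    using in_hprodD[OF a distinct_upt, unfolded indices] by (elim exE conjE)
  \<comment> \<open>Restriction makes the family extensional, as \<open>components\<close> demands,
    without changing the product.\<close>
  have "cprod (\<lambda>i. {restrict z {1..p} i}) = cprod (\<lambda>i. {z i})"
    by (rule hprod_cong) auto
  then have "a \<in> elem_prod H p (restrict z {1..p})"
    unfolding elem_prod_eq using z(2) by simp
  moreover have "restrict z {1..p} \<in> (\<Pi>\<^sub>E i\<in>{1..p}. \<langle>{q i}\<rangle>)"
    using z(1) by (simp add: restrict_PiE_iff closure_q)
  ultimately show "\<exists>x. x \<in> (\<Pi>\<^sub>E i\<in>{1..p}. \<langle>{q i}\<rangle>) \<and> a \<in> elem_prod H p x"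
    by blast
next
  fix x y
  assume x: "x \<in> (\<Pi>\<^sub>E i\<in>{1..p}. \<langle>{q i}\<rangle>) \<and> a \<in> elem_prod H p x"
    and y: "y \<in> (\<Pi>\<^sub>E i\<in>{1..p}. \<langle>{q i}\<rangle>) \<and> a \<in> elem_prod H p y"
  have "w j \<in> {hone H, q j}"
    if "w \<in> (\<Pi>\<^sub>E i\<in>{1..p}. \<langle>{q i}\<rangle>)" "j \<in> {1..p}" for w j
    using PiE_mem[OF that] closure_q[OF that(2)] by simp
  then have "x i = y i" if "i \<in> {1..p}" for i
    using x y that by (intro cprod_components_unique[of x y a i]) (simp_all add: elem_prod_eq)
  then show "x = y"
    using x y by (blast intro: PiE_ext)
qed

text \<open>The second fact is where constrainedness enters: an element is the only one in the
  product of its components.\<close>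

lemma
  assumes "a \<in> carrier H"
  shows comp_PiE: "comp a \<in> (\<Pi>\<^sub>E i\<in>{1..p}. \<langle>{q i}\<rangle>)"
    and comp_cprod: "cprod (\<lambda>i. {comp a i}) = {a}"
  using theI'[OF ex1_components[OF assms]] eah assms
  by (auto simp: components_def elem_prod_eq elementary_abelian_2_hypergroup_def
      constrained_direct_product_def)

lemma comp_in:
  assumes "a \<in> carrier H" "i \<in> {1..p}"
  shows "comp a i \<in> {hone H, q i}"
  using PiE_mem[OF comp_PiE[OF assms(1)] assms(2)] closure_q[OF assms(2)] by simp

lemma comp_unique:
  assumes "\<And>i. i \<in> {1..p} \<Longrightarrow> z i \<in> {hone H, q i}" "a \<in> cprod (\<lambda>i. {z i})"
    and "a \<in> carrier H" "i \<in> {1..p}"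
  shows "comp a i = z i"
  using assms comp_in comp_cprod by (intro cprod_components_unique[of "comp a" z a i]) auto

section \<open>Componentwise multiplication and its consequences\<close>

lemma cprod_mult:
  assumes "\<And>i. i \<in> {1..p} \<Longrightarrow> A i \<subseteq> {hone H, q i}" "\<And>i. i \<in> {1..p} \<Longrightarrow> B i \<subseteq> {hone H, q i}"
  shows "cprod A \<odot> cprod B = cprod (\<lambda>i. A i \<odot> B i)"
  using assms by (intro hprod_components_mult) auto

text \<open>By constrainedness both factors are products of singletons, and the interchange law
  multiplies these index by index.\<close>

lemma hmult_eq_cprod:
  assumes "a \<in> carrier H" "b \<in> carrier H"
  shows "a \<cdot> b = cprod (\<lambda>i. comp a i \<cdot> comp b i)"
  using cprod_mult[of "\<lambda>i. {comp a i}" "\<lambda>i. {comp b i}"] comp_in assms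
  by (simp add: comp_cprod)

lemma hmult_commute:
  assumes "a \<in> carrier H" "b \<in> carrier H"
  shows "a \<cdot> b = b \<cdot> a"
proof -
  have "comp a i \<cdot> comp b i = comp b i \<cdot> comp a i" if "i \<in> {1..p}" for i
    using subset_components_commute[OF that that, of "{comp a i}" "{comp b i}"]
      comp_in[OF assms(1) that] comp_in[OF assms(2) that] by simp
  then have "cprod (\<lambda>i. comp a i \<cdot> comp b i) = cprod (\<lambda>i. comp b i \<cdot> comp a i)"
    by (intro hprod_cong) auto
  then show ?thesis using hmult_eq_cprod assms by simp
qed

lemma hset_mult_commute:
  assumes "A \<subseteq> carrier H" "B \<subseteq> carrier H"
  shows "A \<odot> B = B \<odot> A"
  using assms by (intro hset_mult_commuteI hmult_commute) blast+

text \<open>The square of an element of a component is either the neutral element alone or the pair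
  formed with the element itself; both are closed under multiplication.\<close>

lemma component_square:
  assumes "i \<in> {1..p}" "x \<in> {hone H, q i}"
  shows "hone H \<in> x \<cdot> x" "(x \<cdot> x) \<odot> (x \<cdot> x) = x \<cdot> x"
proof -
  consider "x \<cdot> x = {hone H}" | "x \<in> carrier H" "x \<cdot> x = {hone H, x}"
    using assms(2) involution_mult[OF involution_q[OF assms(1)]] q_closed[OF assms(1)]
    by (elim insertE emptyE disjE) simp_all
  then have "hone H \<in> x \<cdot> x \<and> (x \<cdot> x) \<odot> (x \<cdot> x) = x \<cdot> x"
  proof cases
    case 1
    then show ?thesis by simp
  next
    case 2
    have "{hone H, x} \<odot> {hone H, x} = {hone H, x}"
      using 2(1) by (auto simp: hset_mult_def 2(2))
    then show ?thesis using 2(2) by simp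
  qed
  then show "hone H \<in> x \<cdot> x" "(x \<cdot> x) \<odot> (x \<cdot> x) = x \<cdot> x" by simp_all
qed

lemma hone_in_square:
  assumes "a \<in> carrier H"
  shows "hone H \<in> a \<cdot> a"
  unfolding hmult_eq_cprod[OF assms assms]
  using component_square(1)[OF _ comp_in[OF assms]] by (intro hone_in_hprod) simp

text \<open>The neutral element lies in the square of \<open>a\<close> since it does so in each
  component, and this happens only if \<open>a\<close> is its own star.\<close>

lemma hstar_eq [simp]: "a \<in> carrier H \<Longrightarrow> hstar H a = a"
  using hone_in_square[of a] hone_in_mult_iff[of a a] by simp

lemma thin_iff: "thin H a \<longleftrightarrow> a \<in> carrier H \<and> a \<cdot> a = {hone H}"
  by (simp add: thin_def cong: conj_cong)

lemma closed_subset_iff: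
  "closed_subset H K \<longleftrightarrow> K \<noteq> {} \<and> K \<subseteq> carrier H \<and> K \<odot> K \<subseteq> K"
proof -
  have "hstar H ` K = K" if "K \<subseteq> carrier H"
    using that image_cong[of K K "hstar H" "\<lambda>x. x"] by (simp add: subset_iff)
  then show ?thesis by (simp add: closed_subset_def cong: conj_cong)
qed

text \<open>Any element of the nonempty product of the singletons \<open>{z i}\<close> serves, by
  uniqueness of components. This supplies the witnesses in all later constructions.\<close>

lemma ex_components:
  assumes "\<And>i. i \<in> {1..p} \<Longrightarrow> z i \<in> {hone H, q i}"
  shows "\<exists>x\<in>carrier H. \<forall>i\<in>{1..p}. comp x i = z i"
proof -
  have z: "{z i} \<subseteq> carrier H" if "i \<in> set [1..<Suc p]" for i
    using component_subset_carrier[of i "{z i}"] assms[of i] that by simp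
  obtain x where x: "x \<in> cprod (\<lambda>i. {z i})"
    using hprod_singletons_nonempty[of "[1..<Suc p]" z] z by auto
  moreover have "x \<in> carrier H"
    using x hprod_closed[of "[1..<Suc p]" "\<lambda>i. {z i}"] z by blast
  ultimately show ?thesis
    using comp_unique[OF assms] by blast
qed

lemma comp_hone: "i \<in> {1..p} \<Longrightarrow> comp (hone H) i = hone H"
  by (rule comp_unique) (simp_all add: hprod_hone)

lemma comp_eqI:
  assumes "x \<in> carrier H" "y \<in> carrier H" "\<And>i. i \<in> {1..p} \<Longrightarrow> comp x i = comp y i"
  shows "x = y"
proof -
  have "cprod (\<lambda>i. {comp x i}) = cprod (\<lambda>i. {comp y i})"
    using assms(3) by (intro hprod_cong) auto
  then show ?thesis using assms(1,2) by (simp add: comp_cprod)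
qed

lemma comp_mem_if_mem_mult:
  assumes "a \<in> carrier H" "b \<in> carrier H" "x \<in> a \<cdot> b" "i \<in> {1..p}"
  shows "comp x i \<in> comp a i \<cdot> comp b i"
proof -
  have x: "x \<in> carrier H" using assms hmult_closed by blast
  obtain z where z: "\<forall>i\<in>{1..p}. z i \<in> comp a i \<cdot> comp b i" "x \<in> cprod (\<lambda>i. {z i})"
    using in_hprodD[OF assms(3)[unfolded hmult_eq_cprod[OF assms(1,2)]] distinct_upt, unfolded indices]
    by (elim exE conjE)
  have "z i \<in> {hone H, q i}" if "i \<in> {1..p}" for i
    using component_mult[OF that comp_in[OF assms(1) that] comp_in[OF assms(2) that]] z(1) that
    by (meson subsetD)
  then have "comp x i = z i"
    using z(2) x assms(4) by (rule comp_unique)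
  then show ?thesis using z(1) assms(4) by simp
qed

text \<open>Converse of \<open>comp_mem_if_mem_mult\<close>; together they make membership in a
  product a test in each component.\<close>

lemma mem_multI:
  assumes "a \<in> carrier H" "b \<in> carrier H" "x \<in> carrier H"
    "\<And>i. i \<in> {1..p} \<Longrightarrow> comp x i \<in> comp a i \<cdot> comp b i"
  shows "x \<in> a \<cdot> b"
proof -
  have "cprod (\<lambda>i. {comp x i}) \<subseteq> cprod (\<lambda>i. comp a i \<cdot> comp b i)"
    using assms(4) by (intro hprod_mono) auto
  then show ?thesis
    using assms(1-3) by (simp add: comp_cprod hmult_eq_cprod)
qed

section \<open>Thin elements and their group\<close>

lemma thin_mult_singleton:
  assumes "thin H a" "b \<in> carrier H" "c \<in> a \<cdot> b"
  shows "a \<cdot> b = {c}"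
proof -
  have a: "a \<in> carrier H" "a \<cdot> a = {hone H}" using assms(1) by (simp_all add: thin_iff)
  have c: "c \<in> carrier H" using a(1) assms(2,3) hmult_closed by blast
  have "b \<in> a \<cdot> c" using exchange_right[of c a b] a(1) c assms(2,3) by simp
  then have "a \<cdot> b \<subseteq> {a} \<odot> (a \<cdot> c)"
    unfolding hset_mult_def by blast
  also have "\<dots> = {c}" using hassoc[of a a c] a c by simp
  finally show ?thesis using assms(3) by blast
qed

text \<open>Exchange and thinness of \<open>b\<close> show that \<open>b\<close> times
  \<open>c\<close> is \<open>{a}\<close>. Associativity then identifies the square of
  \<open>c\<close> with that of \<open>a\<close>, so \<open>c\<close> is thin.\<close>

lemma thin_mult:
  assumes "thin H a" "thin H b"
  obtains c where "a \<cdot> b = {c}" "thin H c"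
proof -
  have ab: "a \<in> carrier H" "b \<in> carrier H" using assms by (simp_all add: thin_iff)
  then obtain c where c: "c \<in> a \<cdot> b" using hmult_nonempty by blast
  then have cH: "c \<in> carrier H" using ab hmult_closed by blast
  have abc: "a \<cdot> b = {c}" using thin_mult_singleton assms(1) ab(2) c by blast
  have "a \<in> b \<cdot> c"
    using exchange_left[of c a b] hmult_commute[of c b] ab c cH by simp
  then have "b \<cdot> c = {a}" using thin_mult_singleton assms(2) cH by blast
  then have "c \<cdot> c = a \<cdot> a" using hassoc[of a b c] ab cH abc by simp
  then show thesis using that abc cH assms(1) by (simp add: thin_iff)
qed

lemma thin_hone: "thin H (hone H)"
  by (simp add: thin_iff)

lemma thin_group_simps:
  "carrier (thin_group H) = singletons (thin_part H (carrier H))"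
  "monoid.mult (thin_group H) A B = A \<odot> B"
  "\<one>\<^bsub>thin_group H\<^esub> = {hone H}"
  by (simp_all add: thin_group_def)

lemma carrier_thin_groupE:
  assumes "A \<in> carrier (thin_group H)"
  obtains a where "A = {a}" "thin H a" "a \<in> carrier H"
  using assms by (auto simp: thin_group_simps singletons_def thin_part_def)

lemma carrier_thin_groupI: "thin H a \<Longrightarrow> {a} \<in> carrier (thin_group H)"
  by (auto simp: thin_group_simps singletons_def thin_part_def thin_iff)

lemma thin_group_square:
  "A \<in> carrier (thin_group H) \<Longrightarrow> A \<otimes>\<^bsub>thin_group H\<^esub> A = \<one>\<^bsub>thin_group H\<^esub>"
  by (erule carrier_thin_groupE) (simp add: thin_group_simps thin_iff)

lemma comm_group_thin_group: "comm_group (thin_group H)"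
proof (rule comm_groupI)
  fix A B assume "A \<in> carrier (thin_group H)" "B \<in> carrier (thin_group H)"
  then obtain a b where *: "A = {a}" "thin H a" "a \<in> carrier H" "B = {b}" "thin H b" "b \<in> carrier H"
    by (elim carrier_thin_groupE)
  obtain c where "a \<cdot> b = {c}" "thin H c" using * thin_mult by blast
  then show "A \<otimes>\<^bsub>thin_group H\<^esub> B \<in> carrier (thin_group H)"
    using * carrier_thin_groupI by (simp add: thin_group_simps(2))
  show "A \<otimes>\<^bsub>thin_group H\<^esub> B = B \<otimes>\<^bsub>thin_group H\<^esub> A"
    unfolding thin_group_simps by (rule hset_mult_commute) (use * in simp_all)
  fix C assume "C \<in> carrier (thin_group H)"
  then obtain c where "C = {c}" "c \<in> carrier H" by (elim carrier_thin_groupE)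
  then show "A \<otimes>\<^bsub>thin_group H\<^esub> B \<otimes>\<^bsub>thin_group H\<^esub> C =
      A \<otimes>\<^bsub>thin_group H\<^esub> (B \<otimes>\<^bsub>thin_group H\<^esub> C)"
    unfolding thin_group_simps by (intro hset_mult_assoc) (use * in simp_all)
next
  show "\<one>\<^bsub>thin_group H\<^esub> \<in> carrier (thin_group H)"
    using carrier_thin_groupI[OF thin_hone] by (simp add: thin_group_simps)
next
  fix A assume "A \<in> carrier (thin_group H)"
  then show "\<one>\<^bsub>thin_group H\<^esub> \<otimes>\<^bsub>thin_group H\<^esub> A = A"
    by (elim carrier_thin_groupE) (simp add: thin_group_simps)
next
  fix A assume "A \<in> carrier (thin_group H)"
  then show "\<exists>B\<in>carrier (thin_group H). B \<otimes>\<^bsub>thin_group H\<^esub> A = \<one>\<^bsub>thin_group H\<^esub>"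
    using thin_group_square by blast
qed

lemma elementary_abelian_2_group_thin_group: "elementary_abelian_2_group (thin_group H)"
  unfolding elementary_abelian_2_group_def
  using comm_group_thin_group thin_group_square by blast

text \<open>Every thin element is its own inverse, so closure under products suffices.\<close>

lemma subgroup_thin_part:
  assumes "closed_subset H G"
  shows "subgroup (singletons (thin_part H G)) (thin_group H)"
proof -
  interpret thin: comm_group "thin_group H" by (rule comm_group_thin_group)
  have G: "G \<subseteq> carrier H" "G \<odot> G \<subseteq> G" using assms by (simp_all add: closed_subset_iff)
  have sub: "singletons (thin_part H G) \<subseteq> carrier (thin_group H)"
    using G(1) by (auto simp: thin_group_simps singletons_def thin_part_def)
  show ?thesis
  proof (rule thin.subgroupI[OF sub])
    show "singletons (thin_part H G) \<noteq> {}"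
      using closed_subset_hone[OF assms] thin_hone by (auto simp: singletons_def thin_part_def)
  next
    fix A assume A: "A \<in> singletons (thin_part H G)"
    then have "inv\<^bsub>thin_group H\<^esub> A = A"
      using sub thin_group_square by (intro thin.inv_equality) auto
    then show "inv\<^bsub>thin_group H\<^esub> A \<in> singletons (thin_part H G)"
      using A by simp
  next
    fix A B assume "A \<in> singletons (thin_part H G)" "B \<in> singletons (thin_part H G)"
    then obtain a b where ab: "A = {a}" "B = {b}" "thin H a" "thin H b" "a \<in> G" "b \<in> G"
      by (auto simp: singletons_def thin_part_def)
    obtain c where c: "a \<cdot> b = {c}" "thin H c" using ab(3,4) by (rule thin_mult)
    have "c \<in> G \<odot> G"
      unfolding hset_mult_iff using c(1) ab(5,6) by blast
    then have "c \<in> G" using G(2) by blast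
    then show "A \<otimes>\<^bsub>thin_group H\<^esub> B \<in> singletons (thin_part H G)"
      using c ab by (simp add: thin_group_simps(2) singletons_def thin_part_def)
  qed
qed

end

section \<open>The product \<open>r\<close> of the thick involutions and strong normality\<close>

locale thick_product = constrained_involutions +
  fixes r :: 'a
  assumes r_closed: "r \<in> carrier H"
    and comp_r: "i \<in> {1..p} \<Longrightarrow> comp r i = (if thick H (q i) then q i else hone H)"
begin

lemma comp_r_square:
  assumes "i \<in> {1..p}"
  shows "comp r i \<cdot> comp r i = (if thick H (q i) then {hone H, q i} else {hone H})"
proof -
  have "q i \<cdot> q i = {hone H, q i}" if "thick H (q i)"
    using that involution_mult[OF involution_q[OF assms]] by (auto simp: thick_def thin_iff)
  then show ?thesis using comp_r[OF assms] by simp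
qed

text \<open>At a thick index the square of \<open>r\<close> fills the whole component; at a thin
  index every square is trivial.\<close>

lemma square_subset:
  assumes "a \<in> carrier H"
  shows "a \<cdot> a \<subseteq> r \<cdot> r"
  unfolding hmult_eq_cprod[OF assms assms] hmult_eq_cprod[OF r_closed r_closed]
proof (rule hprod_mono)
  fix i assume "i \<in> set [1..<Suc p]"
  then have i: "i \<in> {1..p}" by simp
  have c: "comp a i \<in> {hone H, q i}" using comp_in[OF assms i] .
  show "comp a i \<cdot> comp a i \<subseteq> comp r i \<cdot> comp r i"
  proof (cases "thick H (q i)")
    case True
    then show ?thesis using comp_r_square[OF i] component_mult[OF i c c] by simp
  next
    case False
    then have "q i \<cdot> q i = {hone H}" using q_closed[OF i] by (simp add: thick_def thin_iff)
    then have "comp a i \<cdot> comp a i = {hone H}" using c by (elim insertE emptyE) simp_all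
    then show ?thesis using comp_r_square[OF i] False by simp
  qed
qed

lemma r_in_square: "r \<in> r \<cdot> r"
proof (rule mem_multI[OF r_closed r_closed r_closed])
  show "comp r i \<in> comp r i \<cdot> comp r i" if "i \<in> {1..p}" for i
    unfolding comp_r_square[OF that] by (simp add: comp_r[OF that])
qed

lemma square_subset_carrier: "r \<cdot> r \<subseteq> carrier H"
  using hmult_closed r_closed by blast

lemma square_idem: "(r \<cdot> r) \<odot> (r \<cdot> r) = r \<cdot> r"
proof -
  have "(r \<cdot> r) \<odot> (r \<cdot> r) = cprod (\<lambda>i. (comp r i \<cdot> comp r i) \<odot> (comp r i \<cdot> comp r i))"
    unfolding hmult_eq_cprod[OF r_closed r_closed]
    using component_mult[OF _ comp_in[OF r_closed] comp_in[OF r_closed]]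
    by (intro cprod_mult) simp_all
  also have "\<dots> = r \<cdot> r"
    unfolding hmult_eq_cprod[OF r_closed r_closed]
    using component_square(2)[OF _ comp_in[OF r_closed]] by (intro hprod_cong) simp
  finally show ?thesis .
qed

lemma closed_square: "closed_subset H (r \<cdot> r)"
  using r_in_square square_subset_carrier square_idem by (auto simp: closed_subset_iff)

lemma square_subset_closed:
  assumes "closed_subset H K" "r \<in> K"
  shows "r \<cdot> r \<subseteq> K"
proof -
  have "{r} \<odot> {r} \<subseteq> K \<odot> K" using assms(2) by (intro hset_mult_mono) simp_all
  also have "\<dots> \<subseteq> K" using assms(1) by (simp add: closed_subset_iff)
  finally show ?thesis by simp
qed

lemma closure_r: "\<langle>{r}\<rangle> = r \<cdot> r"
proof
  show "\<langle>{r}\<rangle> \<subseteq> r \<cdot> r"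
    using closed_square r_in_square by (intro closure_of_set_subset) simp_all
  show "r \<cdot> r \<subseteq> \<langle>{r}\<rangle>"
    unfolding closure_of_set_def using square_subset_closed by (intro Inter_greatest) simp
qed

text \<open>The ambient set is a general \<open>K\<close> because the thin residue of
  \<open>G\<close> is formed inside \<open>G\<close>, not inside the carrier.\<close>

lemma strongly_normal_in_iff:
  assumes "closed_subset H K" "r \<in> K"
  shows "strongly_normal_in H F K \<longleftrightarrow> closed_subset H F \<and> F \<subseteq> K \<and> r \<in> F"
proof (intro iffI conjI; (elim conjE)?)
  assume sn: "strongly_normal_in H F K"
  then show F: "closed_subset H F" and "F \<subseteq> K" by (simp_all add: strongly_normal_in_def)
  \<comment> \<open>Conjugating the neutral element of \<open>F\<close> by \<open>r\<close> gives
    the square of \<open>r\<close>, which contains \<open>r\<close>.\<close>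
  have "{r} \<odot> {hone H} \<odot> {r} \<subseteq> {r} \<odot> F \<odot> {r}"
    using closed_subset_hone[OF F] by (intro hset_mult_mono) simp_all
  also have "\<dots> \<subseteq> F"
    using sn assms(2) r_closed unfolding strongly_normal_in_def by (metis hstar_eq)
  finally show "r \<in> F" using r_in_square r_closed by auto
next
  assume F: "closed_subset H F" "F \<subseteq> K" "r \<in> F"
  have FH: "F \<subseteq> carrier H" and FF: "F \<odot> F \<subseteq> F" using F(1) by (simp_all add: closed_subset_iff)
  have "{hstar H a} \<odot> F \<odot> {a} \<subseteq> F" if "a \<in> K" for a
  proof -
    have a: "a \<in> carrier H" using that assms(1) by (auto simp: closed_subset_iff)
    \<comment> \<open>Since stars are trivial and products commute, conjugation by \<open>a\<close>
      is multiplication by its square, which is absorbed by the square of \<open>r\<close> inside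
      \<open>F\<close>.\<close>
    have "{hstar H a} \<odot> F \<odot> {a} = F \<odot> (a \<cdot> a)"
      using a FH hset_mult_assoc[of F "{a}" "{a}"] hset_mult_commute[of "{a}" F] by simp
    also have "\<dots> \<subseteq> F \<odot> F"
      using square_subset[OF a] square_subset_closed[OF F(1,3)] by (intro hset_mult_mono) simp_all
    finally show ?thesis using FF by simp
  qed
  then show "strongly_normal_in H F K"
    using F assms(1) by (simp add: strongly_normal_in_def)
qed

lemma strongly_normal_carrier_iff:
  "strongly_normal_in H F (carrier H) \<longleftrightarrow> closed_subset H F \<and> r \<in> F"
  using strongly_normal_in_iff[OF closed_subset_carrier r_closed] by (auto simp: closed_subset_iff)

text \<open>The square of \<open>r\<close> is itself one of the sets intersected and lies in all the
  others.\<close>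

lemma thin_residue_eq:
  assumes "closed_subset H K" "r \<in> K"
  shows "thin_residue H K = r \<cdot> r"
  unfolding thin_residue_def closure_of_closed_subset[OF assms(1)] strongly_normal_in_iff[OF assms]
  using closed_square r_in_square square_subset_closed assms by blast

text \<open>A nontrivial component of \<open>y\<close> would be a thick \<open>q i\<close>. Its
  square contains \<open>q i\<close>, so the square of \<open>y\<close> would contain an element
  other than the neutral one.\<close>

lemma thin_in_square:
  assumes "thin H y" "y \<in> r \<cdot> r"
  shows "y = hone H"
proof -
  have y: "y \<in> carrier H" "y \<cdot> y = {hone H}" using assms(1) by (simp_all add: thin_iff)
  have "comp y i = comp (hone H) i" if i: "i \<in> {1..p}" for i
  proof (rule ccontr)
    assume "comp y i \<noteq> comp (hone H) i"
    then have yi: "comp y i \<noteq> hone H" "comp y i = q i"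
      using comp_hone[OF i] comp_in[OF y(1) i] by simp_all
    then have "thick H (q i)"
      using comp_mem_if_mem_mult[OF r_closed r_closed assms(2) i] comp_r_square[OF i]
      by (auto split: if_splits)
    then have sq: "q i \<in> q i \<cdot> q i"
      using comp_r_square[OF i] comp_r[OF i] by simp
    \<comment> \<open>The witness is concentrated at index \<open>i\<close>: elsewhere the neutral
      element is available in every square.\<close>
    have "\<exists>x\<in>carrier H. \<forall>j\<in>{1..p}. comp x j = (if j = i then q i else hone H)"
      by (rule ex_components) simp
    then obtain x where x: "x \<in> carrier H"
      "\<forall>j\<in>{1..p}. comp x j = (if j = i then q i else hone H)"
      by (elim bexE)
    have "x \<in> y \<cdot> y"
      using x sq yi(2) component_square(1)[OF _ comp_in[OF y(1)]]
      by (intro mem_multI[OF y(1) y(1) x(1)]) simp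
    then have "x = hone H" using y(2) by simp
    then show False using x(2) i comp_hone[OF i] yi by simp
  qed
  then show ?thesis by (rule comp_eqI[OF y(1) hone_closed])
qed

text \<open>The components of \<open>a\<close> at thick indices form \<open>x\<close>, the others
  form \<open>t\<close>. The last conjunct recovers \<open>t\<close> from \<open>x\<close> and
  \<open>a\<close>, so that \<open>t\<close> stays in any closed set containing both.\<close>

lemma thick_thin_decomposition:
  assumes "a \<in> carrier H"
  shows "\<exists>x\<in>r \<cdot> r. \<exists>t. thin H t \<and> a \<in> x \<cdot> t \<and> t \<in> x \<cdot> a"
proof -
  have "\<exists>x\<in>carrier H. \<forall>i\<in>{1..p}. comp x i = (if thick H (q i) then comp a i else hone H)"
    by (rule ex_components) (use comp_in[OF assms] in simp)
  then obtain x where x: "x \<in> carrier H"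
    "\<forall>i\<in>{1..p}. comp x i = (if thick H (q i) then comp a i else hone H)"
    by (elim bexE)
  have "\<exists>t\<in>carrier H. \<forall>i\<in>{1..p}. comp t i = (if thick H (q i) then hone H else comp a i)"
    by (rule ex_components) (use comp_in[OF assms] in simp)
  then obtain t where t: "t \<in> carrier H"
    "\<forall>i\<in>{1..p}. comp t i = (if thick H (q i) then hone H else comp a i)"
    by (elim bexE)
  have comp_carrier: "comp a i \<in> carrier H" if "i \<in> {1..p}" for i
    using comp_in[OF assms that] q_closed[OF that] by auto
  have a: "a \<in> x \<cdot> t"
    using x t comp_carrier by (intro mem_multI[OF x(1) t(1) assms]) simp
  then have "t \<in> x \<cdot> a"
    using exchange_right[of a x t] x(1) t(1) assms by simp
  moreover have "x \<in> r \<cdot> r"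
  proof (rule mem_multI[OF r_closed r_closed x(1)])
    show "comp x i \<in> comp r i \<cdot> comp r i" if "i \<in> {1..p}" for i
      unfolding comp_r_square[OF that] using x(2) comp_in[OF assms that] that by simp
  qed
  moreover have "thin H t"
  proof -
    have "comp t i \<cdot> comp t i = {hone H}" if i: "i \<in> {1..p}" for i
    proof (cases "thick H (q i)")
      case False
      then have "q i \<cdot> q i = {hone H}" using q_closed[OF i] by (simp add: thick_def thin_iff)
      then show ?thesis using comp_in[OF t(1) i] by (elim insertE emptyE) simp_all
    qed (use t(2) i in simp)
    then have "t \<cdot> t = cprod (\<lambda>i. {hone H})"
      unfolding hmult_eq_cprod[OF t(1) t(1)] by (intro hprod_cong) simp
    then show ?thesis using t(1) by (simp add: thin_iff hprod_hone)
  qed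
  ultimately show ?thesis using a by blast
qed

lemma closed_subset_decomposition:
  assumes "closed_subset H G" "r \<in> G"
  shows "G = r \<cdot> r \<odot> thin_part H G"
proof
  have G: "G \<subseteq> carrier H" "G \<odot> G \<subseteq> G" using assms(1) by (simp_all add: closed_subset_iff)
  have rr: "r \<cdot> r \<subseteq> G" using square_subset_closed[OF assms] .
  show "G \<subseteq> r \<cdot> r \<odot> thin_part H G"
  proof
    fix a assume a: "a \<in> G"
    then obtain x t where xt: "x \<in> r \<cdot> r" "thin H t" "a \<in> x \<cdot> t" "t \<in> x \<cdot> a"
      using thick_thin_decomposition G(1) by blast
    have "t \<in> G \<odot> G" unfolding hset_mult_iff using xt(1,4) rr a by blast
    then have "t \<in> thin_part H G" using G(2) xt(2) by (auto simp: thin_part_def)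
    then show "a \<in> r \<cdot> r \<odot> thin_part H G" unfolding hset_mult_iff using xt(1,3) by blast
  qed
  have "r \<cdot> r \<odot> thin_part H G \<subseteq> G \<odot> G"
    using rr by (intro hset_mult_mono) (auto simp: thin_part_def)
  then show "r \<cdot> r \<odot> thin_part H G \<subseteq> G" using G(2) by simp
qed

text \<open>After commuting, the square of the product set regroups as the square of
  \<open>r\<close> times itself, which is idempotent, times \<open>F\<close> times \<open>F\<close>,
  which lies in \<open>F\<close>.\<close>

lemma closed_square_mult_subgroup:
  assumes "F \<subseteq> carrier H" "subgroup (singletons F) (thin_group H)"
  shows "closed_subset H (r \<cdot> r \<odot> F)" "r \<in> r \<cdot> r \<odot> F"
proof -
  let ?R = "r \<cdot> r"
  have R: "?R \<subseteq> carrier H" by (rule square_subset_carrier)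
  have "hone H \<in> F"
    using subgroup.one_closed[OF assms(2)] by (auto simp: thin_group_simps singletons_def)
  then show r: "r \<in> ?R \<odot> F"
    unfolding hset_mult_iff using r_in_square r_closed by (intro bexI[of _ r] bexI[of _ "hone H"]) simp_all
  have FF: "F \<odot> F \<subseteq> F"
  proof
    fix c assume "c \<in> F \<odot> F"
    then obtain a b where ab: "a \<in> F" "b \<in> F" "c \<in> a \<cdot> b" by (auto simp: hset_mult_iff)
    then have "{a} \<odot> {b} \<in> singletons F"
      using subgroup.m_closed[OF assms(2), of "{a}" "{b}"]
      by (simp add: thin_group_simps(2) singletons_def)
    then show "c \<in> F" using ab(3) by (auto simp: singletons_def)
  qed
  have "(?R \<odot> F) \<odot> (?R \<odot> F) = ?R \<odot> (F \<odot> (?R \<odot> F))"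
    using R assms(1) by (intro hset_mult_assoc hset_mult_closed)
  also have "F \<odot> (?R \<odot> F) = ?R \<odot> (F \<odot> F)"
    using R assms(1) by (intro hset_mult_left_commute hset_mult_commute)
  also have "?R \<odot> (?R \<odot> (F \<odot> F)) = (?R \<odot> ?R) \<odot> (F \<odot> F)"
    using R assms(1) by (intro hset_mult_assoc[symmetric] hset_mult_closed)
  also have "\<dots> \<subseteq> ?R \<odot> F"
    unfolding square_idem using FF by (intro hset_mult_mono) simp_all
  finally show "closed_subset H (?R \<odot> F)"
    using r hset_mult_closed[OF R assms(1)] by (auto simp: closed_subset_iff)
qed

end

section \<open>Identification of \<open>r\<close> through its support\<close>

context constrained_involutions
begin

text \<open>The support forgets the indices. Since a component is trivial or \<open>q i\<close>, and
  \<open>q\<close> is injective, the index of each element of the support can be read off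
  again.\<close>

lemma supp_eq_thick_iff:
  assumes "x \<in> carrier H"
  shows "supp H p (\<lambda>i. \<langle>{q i}\<rangle>) x = {a \<in> q ` {1..p}. thick H a} \<longleftrightarrow>
    (\<forall>i\<in>{1..p}. comp x i = (if thick H (q i) then q i else hone H))"
    (is "?S = ?T \<longleftrightarrow> _")
proof
  assume eq: "?S = ?T"
  show "\<forall>i\<in>{1..p}. comp x i = (if thick H (q i) then q i else hone H)"
  proof
    fix i assume i: "i \<in> {1..p}"
    show "comp x i = (if thick H (q i) then q i else hone H)"
    proof (cases "thick H (q i)")
      case True
      then have "q i \<in> ?S" using i eq by auto
      then obtain j where j: "j \<in> {1..p}" "comp x j = q i" by (auto simp: supp_def)
      then have "q i = q j" using comp_in[OF assms j(1)] q_neq_hone[OF i] by auto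
      then have "i = j" using q_inj[OF i j(1)] by simp
      then show ?thesis using j True by simp
    next
      case False
      then have "q i \<notin> ?S" using eq by auto
      moreover have "comp x i \<in> comp x ` {1..p}" using i by (rule imageI)
      ultimately have "comp x i \<noteq> q i" using q_neq_hone[OF i] by (auto simp: supp_def)
      then show ?thesis using comp_in[OF assms i] False by simp
    qed
  qed
next
  assume "\<forall>i\<in>{1..p}. comp x i = (if thick H (q i) then q i else hone H)"
  then have "comp x ` {1..p} = (\<lambda>i. if thick H (q i) then q i else hone H) ` {1..p}"
    by (intro image_cong) simp_all
  then show "?S = ?T"
    using q_neq_hone by (auto simp: supp_def split: if_splits)
qed

text \<open>The definite description is meaningful: an element with the prescribed components
  exists, and components determine it.\<close>

lemma thick_product_the:
  "thick_product H p q (THE x. x \<in> carrier H \<and>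
    supp H p (\<lambda>i. \<langle>{q i}\<rangle>) x = {a \<in> q ` {1..p}. thick H a})"
    (is "thick_product H p q (The ?P)")
proof -
  have "\<exists>x\<in>carrier H. \<forall>i\<in>{1..p}. comp x i = (if thick H (q i) then q i else hone H)"
    by (rule ex_components) simp
  then obtain x where x: "x \<in> carrier H"
    "\<forall>i\<in>{1..p}. comp x i = (if thick H (q i) then q i else hone H)"
    by (elim bexE)
  have "?P (The ?P)"
  proof (rule theI)
    show "?P x" using x supp_eq_thick_iff by blast
    show "y = x" if "?P y" for y
      using that x supp_eq_thick_iff[of y] by (elim conjE) (rule comp_eqI, simp_all)
  qed
  then show ?thesis
    using supp_eq_thick_iff by unfold_locales blast+
qed

end

theorem theorem3p13:
  fixes H :: "('a, 'b) hypergroup_scheme" and p :: nat and q :: "nat \<Rightarrow> 'a"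
    and G :: "'a set" and r :: 'a
  assumes "elementary_abelian_2_hypergroup H p q"
    and "G \<subseteq> carrier H"
    and "r = (THE x. x \<in> carrier H \<and>
               supp H p (\<lambda>i. \<langle>{q i}\<rangle>\<^bsub>H\<^esub>) x = {a \<in> q ` {1..p}. thick H a})"
  shows "elementary_abelian_2_group (thin_group H) \<and>
    (strongly_normal_in H G (carrier H) \<longleftrightarrow>
      thin_residue H G = thin_residue H (carrier H) \<and>
      thin_residue H (carrier H) = \<langle>{r}\<rangle>\<^bsub>H\<^esub> \<and>
      (\<exists>F. F \<subseteq> carrier H \<and>
           subgroup (singletons F) (thin_group H) \<and>
           G = \<langle>{r}\<rangle>\<^bsub>H\<^esub> \<odot>\<^bsub>H\<^esub> F \<and>
           \<langle>{r}\<rangle>\<^bsub>H\<^esub> \<inter> F = {hone H} \<and>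
           thin_part H G = F))"
    (is "_ \<and> (_ \<longleftrightarrow> ?residue \<and> ?closure \<and> ?split)")
proof -
  interpret constrained_involutions H p q
    using assms(1)
    by (simp add: constrained_involutions_def constrained_involutions_axioms_def
        elementary_abelian_2_hypergroup_def)
  interpret thick_product H p q r
    unfolding assms(3) by (rule thick_product_the)
  have "?residue \<and> ?closure \<and> ?split" if "strongly_normal_in H G (carrier H)"
  proof -
    have G: "closed_subset H G" "r \<in> G" using that strongly_normal_carrier_iff by blast+
    have "hone H \<in> r \<cdot>\<^bsub>H\<^esub> r \<inter> thin_part H G"
      using closed_subset_hone closed_square G(1) thin_hone by (simp add: thin_part_def)
    \<comment> \<open>The witness for \<open>F\<close> is the thin part of \<open>G\<close>; only
      the neutral element is both thin and in the square of \<open>r\<close>.\<close>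
    then have "r \<cdot>\<^bsub>H\<^esub> r \<inter> thin_part H G = {hone H}"
      using thin_in_square by (auto simp: thin_part_def)
    moreover have "thin_part H G \<subseteq> carrier H" using assms(2) by (auto simp: thin_part_def)
    ultimately show ?thesis
      unfolding closure_r thin_residue_eq[OF G] thin_residue_eq[OF closed_subset_carrier r_closed]
      using subgroup_thin_part[OF G(1)] closed_subset_decomposition[OF G] by blast
  qed
  \<comment> \<open>Here \<open>G\<close> is the square of \<open>r\<close> times \<open>F\<close>,
    a closed set containing \<open>r\<close>.\<close>
  moreover have "strongly_normal_in H G (carrier H)" if ?split
    using that closed_square_mult_subgroup unfolding closure_r strongly_normal_carrier_iff by blast
  ultimately show ?thesis
    using elementary_abelian_2_group_thin_group by blast
qed

end
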